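(* Let $f(x)$ be a polynomial with real coefficients of degree $n$ such that $f(0) \neq 0$. There exists a nonnegative even integer $\nu$ such that \[ Z_f(0,\infty) = V^{(n)}_f(0) - \nu . \]
   Context: For a finite sequence $A = (a_0,a_1,\ldots,a_n)$ of real numbers, the number of sign variations $V(A)$ is defined as follows: let $(a_{j_0},a_{j_1},\ldots,a_{j_k})$ with $j_0<j_1<\cdots<j_k$ be the subsequence of nonzero terms of $A$; then $V(A)$ is the number of indices $i\in\{1,\ldots,k\}$ such that $a_{j_{i-1}}$ and $a_{j_i}$ have opposite signs (so $V(A)=0$ if $A$ has at most one nonzero term). For a polynomial $f$ with real coefficients and $\lambda\in\mathbf{R}$, $V^{(n)}_f(\lambda) = V\left(f(\lambda), f'(\lambda), f''(\lambda),\ldots,f^{(n)}(\lambda)\right)$. In particular, if $f(x)=\sum_{j=0}^n a_jx^j$, then $V^{(n)}_f(0) = V(a_0,a_1,\ldots,a_n)$. For a nonzero polynomial $f$ with real coefficients, $\mu_f(\lambda)$ denotes the multiplicity of $\lambda$ as a root of $f$ (equal to $0$ if $\lambda$ is not a root), and $Z_f(0,\infty) = \sum_{0<\lambda<\infty}\mu_f(\lambda)$ is the number of positive real roots of $f$, counted with multiplicity. *)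

theory Defs
  imports Complex_Main "HOL-Computational_Algebra.Polynomial"
begin

definition sign_variations :: "real list \<Rightarrow> nat" where
  "sign_variations A =
     (let B = filter (\<lambda>a. a \<noteq> 0) A
      in card {i \<in> {1..<length B}. B ! (i - 1) * B ! i < 0})"

definition deriv_sign_variations :: "nat \<Rightarrow> real poly \<Rightarrow> real \<Rightarrow> nat" where
  "deriv_sign_variations n f x =
     sign_variations (map (\<lambda>k. poly ((pderiv ^^ k) f) x) [0..<Suc n])"

text \<open>
  The sum of all multiplicities over \<open>S\<close>, restricted to the actual roots so that for
  \<open>f \<noteq> 0\<close> the index set is finite; all omitted multiplicities are \<open>0\<close>. The value is
  meaningful only for \<open>f \<noteq> 0\<close>.
\<close>
definition root_count :: "real poly \<Rightarrow> real set \<Rightarrow> nat" where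
  "root_count f S = (\<Sum>x | x \<in> S \<and> poly f x = 0. order x f)"

end

theory Submission
  imports Defs
begin

text \<open>
  Multiplying a polynomial by \<open>x - c\<close> with \<open>c > 0\<close> strictly increases the number of sign
  variations of its coefficients, and changes its parity, because that parity is determined by
  the signs of the constant and the leading coefficient. Dividing out all positive roots leaves
  a polynomial without positive roots; by the intermediate value theorem its constant and
  leading coefficients have the same sign, so its number of variations is even.
\<close>

section \<open>Sign variations by recursion on the list\<close>

text \<open>\<open>s\<close> is the last nonzero entry read so far. The start value \<open>0\<close>
  stands for none, since \<open>0 * x < 0\<close> never holds.\<close>

fun variations_from :: "real \<Rightarrow> real list \<Rightarrow> nat" where
  "variations_from s [] = 0"
| "variations_from s (x # xs) =
     (if x = 0 then variations_from s xs
      else of_bool (s * x < 0) + variations_from x xs)"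

lemma variations_from_filter:
  "variations_from s (filter (\<lambda>a. a \<noteq> 0) xs) = variations_from s xs"
  by (induction xs arbitrary: s) auto

lemma variations_from_eq_sum:
  assumes "\<forall>y\<in>set ys. y \<noteq> 0"
  shows "variations_from x ys = (\<Sum>i<length ys. of_bool ((x # ys) ! i * ys ! i < 0))"
  using assms by (induction ys arbitrary: x) (auto simp: sum.lessThan_Suc_shift simp del: sum.lessThan_Suc)

lemma sign_variations_eq_variations_from: "sign_variations xs = variations_from 0 xs"
proof -
  define B where "B = filter (\<lambda>a. a \<noteq> 0) xs"
  have nz: "\<forall>y\<in>set B. y \<noteq> 0"
    by (auto simp: B_def)
  have "card {i \<in> {1..<length B}. B ! (i - 1) * B ! i < 0} = variations_from 0 B"
  proof (cases B)
    case (Cons y ys)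
    have "card {i \<in> {1..<length B}. B ! (i - 1) * B ! i < 0} =
        (\<Sum>i\<in>{1..<length B}. of_bool (B ! (i - 1) * B ! i < 0))"
      by (simp add: of_bool_def sum.If_cases Int_def)
    also have "\<dots> = (\<Sum>i<length ys. of_bool (B ! i * B ! Suc i < 0))"
      by (rule sum.reindex_bij_witness[of _ Suc "\<lambda>i. i - 1"]) (auto simp: Cons)
    also have "\<dots> = variations_from y ys"
      using nz by (simp add: Cons variations_from_eq_sum)
    also have "\<dots> = variations_from 0 B"
      using nz by (simp add: Cons)
    finally show ?thesis .
  qed simp
  then show ?thesis
    by (simp add: sign_variations_def Let_def B_def variations_from_filter)
qed

lemma variations_from_cong_sgn:
  assumes "sgn s = sgn t" "map sgn xs = map sgn ys"
  shows "variations_from s xs = variations_from t ys"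
  using assms
proof (induction xs arbitrary: s t ys)
  case (Cons x xs)
  then obtain y zs where ys: "ys = y # zs" "sgn x = sgn y" "map sgn xs = map sgn zs"
    by (cases ys) auto
  have "s * x < 0 \<longleftrightarrow> t * y < 0"
    using Cons.prems(1) ys(2) by (metis sgn_less sgn_mult)
  moreover have "x = 0 \<longleftrightarrow> y = 0"
    using ys(2) by (metis sgn_eq_0_iff)
  ultimately show ?case
    using Cons.IH[OF Cons.prems(1) ys(3)] Cons.IH[OF ys(2) ys(3)] ys(1) by simp
qed auto

text \<open>Each variation flips the current sign, so the parity only records whether the first and
  the last sign agree.\<close>

lemma even_variations_from_iff:
  assumes "s \<noteq> 0" "xs \<noteq> []" "last xs \<noteq> 0"
  shows "even (variations_from s xs) \<longleftrightarrow> s * last xs > 0"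
  using assms
proof (induction xs arbitrary: s)
  case (Cons x xs)
  show ?case
  proof (cases "xs = []")
    case True
    then show ?thesis
      using Cons.prems by (auto simp: not_less less_le)
  next
    case False
    then show ?thesis
      using Cons by (auto simp: zero_less_mult_iff mult_less_0_iff)
  qed
qed auto

section \<open>Multiplication by a linear factor\<close>

text \<open>
  Coefficients of the product with \<open>x - c\<close>, where \<open>b\<close> is the coefficient preceding the list.
\<close>
fun mult_linear :: "real \<Rightarrow> real \<Rightarrow> real list \<Rightarrow> real list" where
  "mult_linear c b [] = [b]"
| "mult_linear c b (x # xs) = (b - c * x) # mult_linear c x xs"

lemma mult_linear_nonempty [simp]: "mult_linear c b xs \<noteq> []"
  by (cases xs) auto

lemma last_mult_linear: "last (mult_linear c b xs) = last (b # xs)"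
  by (induction xs arbitrary: b) auto

lemma Poly_mult_linear: "Poly (mult_linear c b xs) = pCons b (Poly xs) - smult c (Poly xs)"
  by (induction xs arbitrary: b) auto

lemma coeffs_mult_linear:
  assumes "p \<noteq> 0"
  shows "coeffs ([:-c, 1:] * p) = mult_linear c 0 (coeffs p)"
proof -
  have "[:-c, 1:] * p = Poly (mult_linear c 0 (coeffs p))"
    by (simp add: Poly_mult_linear)
  \<comment> \<open>With a nonzero last entry, \<open>coeffs\<close> has no trailing zeros to strip
    and gives back the list itself.\<close>
  moreover have "last (mult_linear c 0 (coeffs p)) \<noteq> 0"
    using assms by (simp add: last_mult_linear last_coeffs_eq_coeff_degree)
  ultimately show ?thesis
    by (simp add: no_trailing_unfold strip_while_idem_iff)
qed

text \<open>
  Here \<open>s\<close> and \<open>t\<close> carry the signs of the last nonzero coefficients read so far of the polynomial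
  and of its product with \<open>x - c\<close>. A sign change from \<open>s\<close> to \<open>-s\<close> in the polynomial forces the
  sign \<open>s\<close> in the product, so the product can only fall behind while \<open>t\<close> and \<open>s\<close> agree, and then
  by at most one.
\<close>
lemma variations_from_mult_linear_le:
  assumes "c > 0" "s \<noteq> 0" "t \<noteq> 0" "b \<noteq> 0 \<Longrightarrow> s * b > 0" "last (b # xs) \<noteq> 0"
  shows "variations_from s xs + 1 \<le>
           variations_from t (mult_linear c b xs) + of_bool (t * s > 0)"
  using assms(2-5)
proof (induction xs arbitrary: s t b)
  case Nil
  then show ?case
    by (auto simp: zero_less_mult_iff mult_less_0_iff)
next
  case (Cons x xs)
  define p where "p = b - c * x"
  define s' where "s' = (if x = 0 then s else x)"
  define t' where "t' = (if p = 0 then t else p)"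
  have "s' \<noteq> 0" "t' \<noteq> 0" "x \<noteq> 0 \<Longrightarrow> s' * x > 0"
    using Cons.prems by (auto simp: s'_def t'_def zero_less_mult_iff)
  then have IH: "variations_from s' xs + 1 \<le>
      variations_from t' (mult_linear c x xs) + of_bool (t' * s' > 0)"
    using Cons.IH Cons.prems(4) by simp
  have p_sign: "s * p > 0" if "s * x < 0"
  proof -
    have "s * b \<ge> 0"
      using Cons.prems(3) by (cases "b = 0") auto
    moreover have "c * (s * x) < 0"
      using assms(1) that by (simp add: mult_less_0_iff)
    ultimately show ?thesis
      by (simp add: p_def algebra_simps)
  qed
  \<comment> \<open>The term \<open>of_bool (t * s > 0)\<close> acts as a potential: this is the
    balance for reading one coefficient, and adding it to \<open>IH\<close> gives the claim. If
    \<open>s * x < 0\<close>, then \<open>p\<close> has the sign of \<open>s\<close>, so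
    \<open>t' * s' < 0\<close>.\<close>
  have step: "of_bool (s * x < 0) + of_bool (t' * s' > 0) \<le>
      of_bool (t * p < 0) + (of_bool (t * s > 0) :: nat)"
  proof (cases "x = 0")
    case True
    then have "p \<noteq> 0 \<Longrightarrow> s * p > 0"
      using Cons.prems(3) by (simp add: p_def)
    then show ?thesis
      using True Cons.prems(1,2)
      by (auto simp: s'_def t'_def of_bool_def zero_less_mult_iff mult_less_0_iff)
  next
    case False
    then show ?thesis
      using p_sign Cons.prems(1,2)
      by (cases "s > 0"; cases "t > 0") (auto simp: s'_def t'_def of_bool_def zero_less_mult_iff mult_less_0_iff)
  qed
  have "variations_from s (x # xs) = of_bool (s * x < 0) + variations_from s' xs"
    by (simp add: s'_def)
  moreover have "variations_from t (mult_linear c b (x # xs)) =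
      of_bool (t * p < 0) + variations_from t' (mult_linear c x xs)"
    by (simp add: t'_def p_def)
  ultimately show ?case
    using IH step by linarith
qed

text \<open>The constant coefficients \<open>a\<close> and \<open>- (c * a)\<close> have opposite
  signs, so the correction term of \<open>variations_from_mult_linear_le\<close> vanishes at the
  start and the inequality is strict.\<close>

lemma mult_linear_variations:
  assumes "c > 0" "poly g 0 \<noteq> 0"
  shows "variations_from 0 (coeffs g) < variations_from 0 (coeffs ([:-c, 1:] * g))"
proof -
  obtain a p where g: "g = pCons a p" "a \<noteq> 0"
    using assms(2) by (cases g) auto
  then have "coeffs g = a # coeffs p"
    by (simp add: cCons_def)
  moreover have "last (a # coeffs p) \<noteq> 0"
    using g by (simp add: last_coeffs_eq_coeff_degree)
  moreover have "-(c * a) * a < 0"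
    using assms(1) g(2) by (simp add: mult.assoc flip: power2_eq_square)
  moreover have "coeffs ([:-c, 1:] * g) = - (c * a) # mult_linear c a (coeffs p)"
    using coeffs_mult_linear[of g c] g calculation(1) by (simp del: mult_pCons_left)
  ultimately show ?thesis
    using variations_from_mult_linear_le[of c a "- (c * a)" a "coeffs p"] assms(1) g(2)
    by (cases "a > 0") (auto simp del: last.simps mult_pCons_left simp: zero_less_mult_iff mult_less_0_iff)
qed

section \<open>Parity and the existence of positive roots\<close>

lemma even_variations_coeffs_iff:
  assumes "poly f 0 \<noteq> 0"
  shows "even (variations_from 0 (coeffs f)) \<longleftrightarrow> poly f 0 * lead_coeff f > 0"
proof -
  obtain a p where f: "f = pCons a p" "a \<noteq> 0"
    using assms by (cases f) auto
  then have "coeffs f = a # coeffs p"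
    by (simp add: cCons_def)
  then show ?thesis
    using even_variations_from_iff[of a "coeffs p"] f
    by (cases "p = 0") (auto simp: last_coeffs_eq_coeff_degree zero_less_mult_iff)
qed

lemma exists_pos_root:
  fixes f :: "real poly"
  assumes "poly f 0 * lead_coeff f < 0"
  shows "\<exists>c>0. poly f c = 0"
proof -
  have pos: "\<exists>c>0. poly p c = 0" if "poly p 0 < 0" "lead_coeff p > 0" for p :: "real poly"
  proof -
    obtain N where "\<forall>x\<ge>N. lead_coeff p \<le> poly p x"
      using poly_pinfty_gt_lc \<open>lead_coeff p > 0\<close> by blast
    \<comment> \<open>The bound \<open>N\<close> may be negative; the maximum with \<open>1\<close>
      keeps the right endpoint positive.\<close>
    then have "0 < poly p (max N 1)"
      using \<open>lead_coeff p > 0\<close> by (meson less_le_trans max.cobounded1)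
    then show ?thesis
      using poly_IVT_pos[of 0 "max N 1" p] that(1) by (meson less_max_iff_disj zero_less_one)
  qed
  show ?thesis
    using assms pos[of f] pos[of "-f"] by (auto simp: mult_less_0_iff)
qed

section \<open>Counting roots by splitting them off\<close>

lemma root_count_mult_linear:
  assumes "g \<noteq> 0" "c \<in> S"
  shows "root_count ([:-c, 1:] * g) S = Suc (root_count g S)"
proof -
  let ?f = "[:-c, 1:] * g"
  \<comment> \<open>\<open>c\<close> need not be a root of \<open>g\<close>; in that case it
    contributes order \<open>0\<close> to the sum for \<open>g\<close>.\<close>
  let ?R = "insert c {x \<in> S. poly g x = 0}"
  have fin: "finite {x. poly g x = 0}"
    by (rule poly_roots_finite[OF assms(1)])
  have f0: "?f \<noteq> 0"
    using assms(1) by (metis mult_eq_0_iff pCons_eq_0_iff one_neq_zero)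
  have order: "order x ?f = of_bool (x = c) + order x g" for x
  proof -
    have "order x [:-c, 1:] = of_bool (x = c)"
      using order_power_n_n[of c 1] by (auto simp: order_0I)
    then show ?thesis
      using order_mult[OF f0] by simp
  qed
  have "root_count ?f S = (\<Sum>x\<in>?R. of_bool (x = c) + order x g)"
    unfolding root_count_def order using assms(2) by (intro sum.cong) auto
  also have "\<dots> = 1 + (\<Sum>x\<in>?R. order x g)"
    using fin by (simp add: sum.distrib of_bool_def)
  also have "(\<Sum>x\<in>?R. order x g) = root_count g S"
    unfolding root_count_def using assms fin
    by (intro sum.mono_neutral_right) (auto simp: order_root)
  finally show ?thesis
    by simp
qed

lemma descartes_variations:
  fixes f :: "real poly"
  assumes "poly f 0 \<noteq> 0"
  shows "root_count f {0<..} \<le> variations_from 0 (coeffs f) \<and>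
         (even (root_count f {0<..}) \<longleftrightarrow> even (variations_from 0 (coeffs f)))"
  using assms
proof (induction "degree f" arbitrary: f rule: less_induct)
  case less
  show ?case
  proof (cases "\<exists>c>0. poly f c = 0")
    case True
    then obtain c g where c: "c > 0" and f: "f = [:-c, 1:] * g"
      by (metis poly_eq_0_iff_dvd dvdE)
    have g0: "poly g 0 \<noteq> 0"
      using less.prems f by auto
    then have g: "g \<noteq> 0"
      by auto
    have lc: "lead_coeff f = lead_coeff g"
      unfolding f lead_coeff_mult by simp
    have "degree g < degree f"
      unfolding f using g by (subst degree_mult_eq) auto
    then have IH: "root_count g {0<..} \<le> variations_from 0 (coeffs g)"
      "even (root_count g {0<..}) \<longleftrightarrow> even (variations_from 0 (coeffs g))"
      using less.hyps g0 by auto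
    have "root_count f {0<..} = Suc (root_count g {0<..})"
      unfolding f using root_count_mult_linear g c by simp
    moreover have "variations_from 0 (coeffs g) < variations_from 0 (coeffs f)"
      unfolding f by (rule mult_linear_variations[OF c g0])
    moreover have "even (variations_from 0 (coeffs f)) \<longleftrightarrow>
        odd (variations_from 0 (coeffs g))"
    proof -
      \<comment> \<open>The constant coefficient gains the factor \<open>-c\<close> and the leading
        one is unchanged, so their product changes sign.\<close>
      have "poly f 0 * lead_coeff f = - (c * (poly g 0 * lead_coeff g))"
        unfolding lc by (simp add: f)
      moreover have "poly g 0 * lead_coeff g \<noteq> 0"
        using g g0 by simp
      ultimately show ?thesis
        using even_variations_coeffs_iff[OF less.prems] even_variations_coeffs_iff[OF g0] c
        by (auto simp: zero_less_mult_iff mult_less_0_iff)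
    qed
    ultimately show ?thesis
      using IH by auto
  next
    case False
    then have "{x \<in> {0<..}. poly f x = 0} = {}"
      by auto
    then have "root_count f {0<..} = 0"
      unfolding root_count_def by (metis (no_types) sum.empty)
    moreover have "poly f 0 * lead_coeff f > 0"
      using exists_pos_root[of f] False less.prems
      by (metis leading_coeff_0_iff linorder_neqE_linordered_idom mult_eq_0_iff poly_0)
    ultimately show ?thesis
      using even_variations_coeffs_iff[OF less.prems] by simp
  qed
qed

section \<open>Derivatives at zero\<close>

text \<open>The k-th derivative at \<open>0\<close> is k! times the k-th coefficient, and k! is
  positive, so the signs agree.\<close>

lemma deriv_sign_variations_0:
  assumes "f \<noteq> 0"
  shows "deriv_sign_variations (degree f) f 0 = variations_from 0 (coeffs f)"
proof -
  have "sgn (poly ((pderiv ^^ k) f) 0) = sgn (coeff f k)" for k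
    by (simp add: poly_0_coeff_0 coeff_higher_pderiv sgn_mult flip: pochhammer_fact)
  then have "map sgn (map (\<lambda>k. poly ((pderiv ^^ k) f) 0) [0..<Suc (degree f)]) =
      map sgn (coeffs f)"
    using assms by (simp add: coeffs_def)
  then show ?thesis
    unfolding deriv_sign_variations_def sign_variations_eq_variations_from
    by (intro variations_from_cong_sgn) auto
qed

theorem theorem1:
  fixes f :: "real poly" and n :: nat
  assumes "degree f = n"
    and "poly f 0 \<noteq> 0"
  shows "\<exists>\<nu>::nat. even \<nu> \<and>
    int (root_count f {0<..}) = int (deriv_sign_variations n f 0) - int \<nu>"
proof -
  have "f \<noteq> 0"
    using assms(2) by auto
  then have "deriv_sign_variations n f 0 = variations_from 0 (coeffs f)"
    using deriv_sign_variations_0 assms(1) by auto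
  \<comment> \<open>The bound makes the subtraction of natural numbers exact; equal parities make
    the difference even.\<close>
  with descartes_variations[OF assms(2)] show ?thesis
    by (intro exI[of _ "deriv_sign_variations n f 0 - root_count f {0<..}"]) auto
qed

end
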